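(* Let $F$ be a free group of rank greater than one. Then there exist subgroups $A, B \leq F$ and an isomorphism $\phi: A \to B$ such that the HNN extension $(F, A, B, t, \phi)$ is not left-orderable.
   Context: Given a group $G$, subgroups $A, B \leq G$ and an isomorphism $\phi: A \to B$, the HNN extension $(G, A, B, t, \phi)$ is the quotient of the free product $G \ast \langle t \rangle$ (with $\langle t\rangle$ infinite cyclic) by the normal closure of the set $\{ t a t^{-1} \phi(a)^{-1} : a \in A\}$. A group is left-orderable if it admits a total order invariant under left multiplication. *)

theory Defs
  imports "HOL-Algebra.Algebra"
begin

text \<open>A letter is a pair (generator, exponent sign); True means exponent +1, False means -1.\<close>

fun reduced :: "('a \<times> bool) list \<Rightarrow> bool" where
  "reduced [] = True"
| "reduced [x] = True"
| "reduced (x # y # ws) = (\<not> (fst x = fst y \<and> snd x \<noteq> snd y) \<and> reduced (y # ws))"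

definition free_reduce :: "('a \<times> bool) list \<Rightarrow> ('a \<times> bool) list" where
  "free_reduce ws = foldr (\<lambda>w acc. case acc of
        [] \<Rightarrow> [w]
      | v # rest \<Rightarrow> (if fst v = fst w \<and> snd v \<noteq> snd w then rest else w # acc)) ws []"

definition free_group :: "'a set \<Rightarrow> (('a \<times> bool) list) monoid" where
  "free_group S = \<lparr> carrier = {w. fst ` set w \<subseteq> S \<and> reduced w},
                    monoid.mult = (\<lambda>u v. free_reduce (u @ v)),
                    monoid.one = [] \<rparr>"

definition normal_closure :: "('a, 'b) monoid_scheme \<Rightarrow> 'a set \<Rightarrow> 'a set" where
  "normal_closure G R =
     generate G (\<Union>g\<in>carrier G. \<Union>r\<in>R. {g \<otimes>\<^bsub>G\<^esub> r \<otimes>\<^bsub>G\<^esub> inv\<^bsub>G\<^esub> g})"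

definition presented_group ::
  "'a set \<Rightarrow> ('a \<times> bool) list set \<Rightarrow> (('a \<times> bool) list set) monoid" where
  "presented_group S R = free_group S Mod normal_closure (free_group S) (free_reduce ` R)"

text \<open>HNN extension (G, A, B, t, phi): the free product G * <t> (presented by generators
  carrier G plus a new letter t = None, with the multiplication table of G as relators)
  modulo the normal closure of the relators t a t^-1 phi(a)^-1 for a in A.
  B is implicitly phi ` A.\<close>
definition HNN :: "('g, 'b) monoid_scheme \<Rightarrow> 'g set \<Rightarrow> ('g \<Rightarrow> 'g)
                    \<Rightarrow> ((('g option) \<times> bool) list set) monoid" where
  "HNN G A \<phi> = presented_group (insert None (Some ` carrier G))
     ((\<Union>a\<in>carrier G. \<Union>b\<in>carrier G.
         {[(Some a, True), (Some b, True), (Some (a \<otimes>\<^bsub>G\<^esub> b), False)]})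
      \<union> (\<Union>a\<in>A. {[(None, True), (Some a, True), (None, False), (Some (\<phi> a), False)]}))"

definition left_orderable :: "('a, 'b) monoid_scheme \<Rightarrow> bool" where
  "left_orderable G \<longleftrightarrow> (\<exists>le :: 'a \<Rightarrow> 'a \<Rightarrow> bool.
      (\<forall>x\<in>carrier G. le x x)
    \<and> (\<forall>x\<in>carrier G. \<forall>y\<in>carrier G. le x y \<and> le y x \<longrightarrow> x = y)
    \<and> (\<forall>x\<in>carrier G. \<forall>y\<in>carrier G. \<forall>z\<in>carrier G. le x y \<and> le y z \<longrightarrow> le x z)
    \<and> (\<forall>x\<in>carrier G. \<forall>y\<in>carrier G. le x y \<or> le y x)
    \<and> (\<forall>g\<in>carrier G. \<forall>x\<in>carrier G. \<forall>y\<in>carrier G.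
          le x y \<longrightarrow> le (g \<otimes>\<^bsub>G\<^esub> x) (g \<otimes>\<^bsub>G\<^esub> y)))"

end

theory Submission
  imports Defs
begin

text \<open>Let x and p be distinct free generators and put \<open>g\<^sub>n = x\<^sup>n p x\<^sup>n\<close> for integers n. The \<open>g\<^sub>n\<close>
  freely generate a subgroup A, so \<open>g\<^sub>n \<mapsto> g\<^sub>n\<close> (n even), \<open>g\<^sub>n \<mapsto> g\<^sub>n\<^sup>-\<^sup>1\<close> (n odd) defines an
  automorphism of A. Since \<open>g\<^bsub>n+1\<^esub> = x g\<^sub>n x\<close>, the signs of the \<open>g\<^sub>n\<close> are monotone in n for
  every left order. In the HNN extension, conjugation by t turns a left order into another one in
  which exactly the signs with odd index are flipped, and two monotone sign sequences cannot differ
  in this way. The argument needs \<open>g\<^sub>n \<noteq> 1\<close> in the HNN extension, which holds because the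
  parity of the exponent of p survives there.\<close>

section \<open>Free groups\<close>

definition cancel_cons :: "'a \<times> bool \<Rightarrow> ('a \<times> bool) list \<Rightarrow> ('a \<times> bool) list" where
  "cancel_cons l w = (case w of [] \<Rightarrow> [l]
      | v # rest \<Rightarrow> (if fst v = fst l \<and> snd v \<noteq> snd l then rest else l # w))"

lemma free_reduce_foldr: "free_reduce w = foldr cancel_cons w []"
  unfolding free_reduce_def cancel_cons_def by simp

lemma free_reduce_Nil [simp]: "free_reduce [] = []"
  by (simp add: free_reduce_foldr)

lemma free_reduce_Cons: "free_reduce (l # w) = cancel_cons l (free_reduce w)"
  by (simp add: free_reduce_foldr)

lemma reduced_tl: "reduced (l # w) \<Longrightarrow> reduced w"
  by (cases w) auto

lemma reduced_cancel_cons: "reduced w \<Longrightarrow> reduced (cancel_cons l w)"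
  by (cases w) (auto simp: cancel_cons_def dest: reduced_tl)

lemma reduced_free_reduce: "reduced (free_reduce w)"
  by (induction w) (simp_all add: free_reduce_Cons reduced_cancel_cons)

lemma cancel_cons_reduced: "reduced (l # w) \<Longrightarrow> cancel_cons l w = l # w"
  by (cases w) (auto simp: cancel_cons_def)

lemma free_reduce_reduced: "reduced w \<Longrightarrow> free_reduce w = w"
proof (induction w)
  case (Cons l w)
  then show ?case using reduced_tl[of l w] by (simp add: free_reduce_Cons cancel_cons_reduced)
qed simp

lemma set_cancel_cons: "set (cancel_cons l w) \<subseteq> insert l (set w)"
  by (cases w) (auto simp: cancel_cons_def)

lemma set_free_reduce: "set (free_reduce w) \<subseteq> set w"
  by (induction w) (use set_cancel_cons in \<open>fastforce simp: free_reduce_Cons\<close>)+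

text \<open>If \<open>w\<close> begins with \<open>(s, b)\<close>, the inner call deletes that
  letter and the outer one must put it back. It would cancel instead only if the tail began with
  \<open>(s, \<not> b)\<close>, which reducedness of \<open>w\<close> forbids.\<close>

lemma cancel_cons_inverse:
  assumes "reduced w"
  shows "cancel_cons (s, b) (cancel_cons (s, \<not> b) w) = w"
proof (cases w)
  case (Cons v rest)
  then show ?thesis
    using assms by (cases v; cases rest) (auto simp: cancel_cons_def)
qed (simp add: cancel_cons_def)

text \<open>Whenever opposite letters act by mutually inverse maps, a word and its reduction act
  alike. This one fact yields associativity, the universal property, the parity invariant and the
  action that proves freeness.\<close>

lemma foldr_free_reduce:
  assumes closed: "\<And>l q. fst l \<in> S \<Longrightarrow> q \<in> Q \<Longrightarrow> act l q \<in> Q"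
    and inverse: "\<And>s b q. s \<in> S \<Longrightarrow> q \<in> Q \<Longrightarrow> act (s, b) (act (s, \<not> b) q) = q"
    and q: "q \<in> Q" and w: "fst ` set w \<subseteq> S"
  shows "foldr act (free_reduce w) q = foldr act w q"
  using w
proof (induction w)
  case (Cons l w)
  have mem: "foldr act u q \<in> Q" if "fst ` set u \<subseteq> S" for u
    using that by (induction u) (auto intro: closed q)
  have sub: "fst ` set (free_reduce w) \<subseteq> S"
    using Cons.prems set_free_reduce[of w] by auto
  \<comment> \<open>The only nontrivial case is a cancellation: the reduction of \<open>w\<close>
    then starts with the inverse of \<open>l\<close>, and the two maps undo each other.\<close>
  have "foldr act (cancel_cons l (free_reduce w)) q = act l (foldr act (free_reduce w) q)"
  proof (cases "free_reduce w")
    case (Cons v rest)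
    obtain s b where l: "l = (s, b)" by (cases l)
    show ?thesis
    proof (cases "fst v = fst l \<and> snd v \<noteq> snd l")
      case True
      then have "v = (s, \<not> b)" using l by (cases v) auto
      moreover have "foldr act rest q \<in> Q" using sub Cons by (intro mem) auto
      moreover have "s \<in> S" using Cons.prems l by auto
      ultimately show ?thesis using Cons l by (simp add: cancel_cons_def inverse)
    qed (auto simp: Cons cancel_cons_def)
  qed (simp add: cancel_cons_def)
  then show ?case using Cons by (simp add: free_reduce_Cons)
qed simp

section \<open>Group structure on reduced words\<close>

lemma foldr_cancel_cons_free_reduce:
  "reduced r \<Longrightarrow> foldr cancel_cons (free_reduce w) r = foldr cancel_cons w r"
  by (rule foldr_free_reduce[where S = UNIV and Q = "Collect reduced"])
    (auto simp: reduced_cancel_cons cancel_cons_inverse)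

lemma free_reduce_append: "free_reduce (u @ v) = foldr cancel_cons u (free_reduce v)"
  by (simp add: free_reduce_foldr)

lemma carrier_free_group: "carrier (free_group S) = {w. fst ` set w \<subseteq> S \<and> reduced w}"
  and mult_free_group: "u \<otimes>\<^bsub>free_group S\<^esub> v = free_reduce (u @ v)"
  and one_free_group: "\<one>\<^bsub>free_group S\<^esub> = []"
  by (simp_all add: free_group_def)

lemma free_reduce_in_carrier:
  "fst ` set w \<subseteq> S \<Longrightarrow> free_reduce w \<in> carrier (free_group S)"
  using set_free_reduce[of w] by (auto simp: carrier_free_group reduced_free_reduce)

lemma free_reduce_inverse_word:
  "free_reduce (rev (map (\<lambda>l. (fst l, \<not> snd l)) w) @ w) = []"
proof (induction w)
  case (Cons l w)
  have "cancel_cons (fst l, \<not> snd l) (cancel_cons l (free_reduce w)) = free_reduce w"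
    using cancel_cons_inverse[OF reduced_free_reduce, of "fst l" "\<not> snd l" w] by simp
  then show ?case using Cons by (simp add: free_reduce_append free_reduce_Cons)
qed simp

lemma group_free_group: "group (free_group S)"
proof (rule groupI)
  fix u v w assume "u \<in> carrier (free_group S)" "v \<in> carrier (free_group S)"
    "w \<in> carrier (free_group S)"
  then show "u \<otimes>\<^bsub>free_group S\<^esub> v \<otimes>\<^bsub>free_group S\<^esub> w
      = u \<otimes>\<^bsub>free_group S\<^esub> (v \<otimes>\<^bsub>free_group S\<^esub> w)"
    \<comment> \<open>Both bracketings equal the letters of \<open>u @ v\<close> acting by
      \<open>cancel_cons\<close> on the reduction of \<open>w\<close>.\<close>
    using foldr_cancel_cons_free_reduce[OF reduced_free_reduce, of "u @ v" w]
      free_reduce_reduced[OF reduced_free_reduce, of "v @ w"]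
    by (simp add: mult_free_group free_reduce_append)
next
  fix u assume u: "u \<in> carrier (free_group S)"
  let ?v = "free_reduce (rev (map (\<lambda>l. (fst l, \<not> snd l)) u))"
  have "?v \<in> carrier (free_group S)"
    using u by (intro free_reduce_in_carrier) (auto simp: carrier_free_group)
  moreover have "free_reduce (?v @ u) = []"
    using free_reduce_inverse_word[of u]
    by (simp add: free_reduce_append foldr_cancel_cons_free_reduce reduced_free_reduce)
  ultimately show "\<exists>v\<in>carrier (free_group S). v \<otimes>\<^bsub>free_group S\<^esub> u = \<one>\<^bsub>free_group S\<^esub>"
    by (auto simp: mult_free_group one_free_group)
next
  fix u v assume "u \<in> carrier (free_group S)" "v \<in> carrier (free_group S)"
  then show "u \<otimes>\<^bsub>free_group S\<^esub> v \<in> carrier (free_group S)"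
    unfolding mult_free_group
    by (intro free_reduce_in_carrier) (auto simp: carrier_free_group)
qed (auto simp: mult_free_group one_free_group carrier_free_group free_reduce_reduced)

lemma letter_in_carrier: "s \<in> S \<Longrightarrow> [(s, b)] \<in> carrier (free_group S)"
  by (simp add: carrier_free_group)

lemma inv_letter:
  assumes "s \<in> S"
  shows "inv\<^bsub>free_group S\<^esub> [(s, b)] = [(s, \<not> b)]"
proof -
  interpret group "free_group S" by (rule group_free_group)
  show ?thesis
    by (rule inv_equality)
      (auto simp: assms letter_in_carrier mult_free_group one_free_group
        free_reduce_Cons cancel_cons_def)
qed

lemma foldr_mult_free_group:
  assumes "\<And>l q. q \<in> Q \<Longrightarrow> act l q \<in> Q"
    and "\<And>s b q. q \<in> Q \<Longrightarrow> act (s, b) (act (s, \<not> b) q) = q"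
    and "q \<in> Q"
  shows "foldr act (u \<otimes>\<^bsub>free_group S\<^esub> v) q = foldr act u (foldr act v q)"
  unfolding mult_free_group using foldr_free_reduce[of UNIV Q act q "u @ v"] assms by simp

section \<open>The universal property\<close>

text \<open>Evaluation is defined on all words, not only reduced ones, so that relators can be
  evaluated as they are written.\<close>

definition free_lift :: "('g, 'm) monoid_scheme \<Rightarrow> ('a \<Rightarrow> 'g) \<Rightarrow> ('a \<times> bool) list \<Rightarrow> 'g" where
  "free_lift G f w =
     foldr (\<lambda>l g. (if snd l then f (fst l) else inv\<^bsub>G\<^esub> f (fst l)) \<otimes>\<^bsub>G\<^esub> g) w \<one>\<^bsub>G\<^esub>"

lemma free_lift_Nil [simp]: "free_lift G f [] = \<one>\<^bsub>G\<^esub>"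
  by (simp add: free_lift_def)

lemma free_lift_Cons:
  "free_lift G f ((s, b) # w) = (if b then f s else inv\<^bsub>G\<^esub> f s) \<otimes>\<^bsub>G\<^esub> free_lift G f w"
  by (simp add: free_lift_def)

context group
begin

lemma free_lift_closed:
  "f \<in> S \<rightarrow> carrier G \<Longrightarrow> fst ` set w \<subseteq> S \<Longrightarrow> free_lift G f w \<in> carrier G"
  by (induction w) (auto simp: free_lift_Cons Pi_iff)

lemma free_lift_append:
  "f \<in> S \<rightarrow> carrier G \<Longrightarrow> fst ` set u \<subseteq> S \<Longrightarrow> fst ` set v \<subseteq> S \<Longrightarrow>
    free_lift G f (u @ v) = free_lift G f u \<otimes> free_lift G f v"
  by (induction u) (auto simp: free_lift_Cons m_assoc free_lift_closed Pi_iff)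

lemma free_lift_free_reduce:
  assumes "f \<in> S \<rightarrow> carrier G" "fst ` set w \<subseteq> S"
  shows "free_lift G f (free_reduce w) = free_lift G f w"
  unfolding free_lift_def
  by (rule foldr_free_reduce[where S = S and Q = "carrier G"])
    (use assms in \<open>auto simp: m_assoc[symmetric] Pi_iff\<close>)

lemma free_lift_hom:
  assumes "f \<in> S \<rightarrow> carrier G"
  shows "free_lift G f \<in> hom (free_group S) G"
  by (rule homI)
    (use assms in \<open>auto simp: carrier_free_group mult_free_group free_lift_closed
      free_lift_append free_lift_free_reduce image_Un\<close>)

end

section \<open>Parity of the number of marked letters\<close>

text \<open>The homomorphism to Z/2 taking marked generators to 1. Exponent signs can be ignored
  modulo 2.\<close>

definition word_parity :: "('a \<Rightarrow> bool) \<Rightarrow> ('a \<times> bool) list \<Rightarrow> bool" where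
  "word_parity d w = foldr (\<lambda>l q. q \<noteq> d (fst l)) w False"

lemma word_parity_Nil [simp]: "\<not> word_parity d []"
  by (simp add: word_parity_def)

lemma word_parity_Cons [simp]: "word_parity d (l # w) = (word_parity d w \<noteq> d (fst l))"
  by (simp add: word_parity_def)

lemma word_parity_append: "word_parity d (u @ v) = (word_parity d u \<noteq> word_parity d v)"
  by (induction u) auto

lemma word_parity_free_reduce: "word_parity d (free_reduce w) = word_parity d w"
  unfolding word_parity_def
  by (rule foldr_free_reduce[where S = UNIV and Q = UNIV]) auto

lemma word_parity_mult:
  "word_parity d (u \<otimes>\<^bsub>free_group S\<^esub> v) = (word_parity d u \<noteq> word_parity d v)"
  by (simp add: mult_free_group word_parity_free_reduce word_parity_append)

lemma word_parity_inv:
  assumes "u \<in> carrier (free_group S)"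
  shows "word_parity d (inv\<^bsub>free_group S\<^esub> u) = word_parity d u"
  using word_parity_mult[of d S "inv\<^bsub>free_group S\<^esub> u" u] group.l_inv[OF group_free_group assms]
  by (simp add: one_free_group)

section \<open>Presented groups\<close>

lemma (in group) normal_closure_normal:
  assumes "R \<subseteq> carrier G"
  shows "normal_closure G R \<lhd> G"
  unfolding normal_closure_def
proof (rule normal_generateI)
  fix h g assume h: "h \<in> (\<Union>g\<in>carrier G. \<Union>r\<in>R. {g \<otimes> r \<otimes> inv g})" and g: "g \<in> carrier G"
  then obtain k r where kr: "k \<in> carrier G" "r \<in> R" "h = k \<otimes> r \<otimes> inv k" by blast
  then have "g \<otimes> h \<otimes> inv g = (g \<otimes> k) \<otimes> r \<otimes> inv (g \<otimes> k)"
    using g assms by (auto simp: m_assoc inv_mult_group subset_iff)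
  then show "g \<otimes> h \<otimes> inv g \<in> (\<Union>g\<in>carrier G. \<Union>r\<in>R. {g \<otimes> r \<otimes> inv g})"
    using kr g by blast
qed (use assms in auto)

lemma (in group) normal_closure_incl:
  assumes "R \<subseteq> carrier G"
  shows "R \<subseteq> normal_closure G R"
proof
  fix r assume "r \<in> R"
  moreover from this have "r = \<one> \<otimes> r \<otimes> inv \<one>" using assms by auto
  ultimately show "r \<in> normal_closure G R"
    unfolding normal_closure_def by (blast intro: generate.incl)
qed

definition presented_gen :: "'a set \<Rightarrow> ('a \<times> bool) list set \<Rightarrow> 'a \<Rightarrow> ('a \<times> bool) list set" where
  "presented_gen S R s =
     normal_closure (free_group S) (free_reduce ` R) #>\<^bsub>free_group S\<^esub> [(s, True)]"

locale presentation =
  fixes S :: "'a set" and R :: "('a \<times> bool) list set"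
  assumes relators: "r \<in> R \<Longrightarrow> fst ` set r \<subseteq> S"
begin

abbreviation N where "N \<equiv> normal_closure (free_group S) (free_reduce ` R)"

lemma reduced_relators: "free_reduce ` R \<subseteq> carrier (free_group S)"
  using relators by (auto intro!: free_reduce_in_carrier)

lemma normal_N: "N \<lhd> free_group S"
  by (rule group.normal_closure_normal[OF group_free_group reduced_relators])

lemma group_presented_group: "group (presented_group S R)"
  unfolding presented_group_def by (rule normal.factorgroup_is_group[OF normal_N])

lemma quotient_hom: "(\<lambda>w. N #>\<^bsub>free_group S\<^esub> w) \<in> hom (free_group S) (presented_group S R)"
  unfolding presented_group_def by (rule normal.r_coset_hom_Mod[OF normal_N])

lemma presented_gen_closed: "s \<in> S \<Longrightarrow> presented_gen S R s \<in> carrier (presented_group S R)"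
  unfolding presented_gen_def by (rule hom_in_carrier[OF quotient_hom letter_in_carrier])

text \<open>The quotient map is a homomorphism, so it can be computed letter by letter. Applied to a
  relator, this gives an equation between generators of the quotient.\<close>

lemma free_lift_presented_gen:
  "fst ` set w \<subseteq> S \<Longrightarrow>
    free_lift (presented_group S R) (presented_gen S R) w = N #>\<^bsub>free_group S\<^esub> free_reduce w"
proof (induction w)
  case Nil
  show ?case
    using hom_one[OF quotient_hom group_free_group group_presented_group]
    by (simp add: one_free_group)
next
  case (Cons l w)
  interpret quot: group_hom "free_group S" "presented_group S R" "\<lambda>w. N #>\<^bsub>free_group S\<^esub> w"
    using group_free_group group_presented_group quotient_hom
    by (simp add: group_hom_def group_hom_axioms_def)
  obtain s b where l: "l = (s, b)" by (cases l)
  have s: "s \<in> S" using Cons.prems l by simp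
  have w: "free_reduce w \<in> carrier (free_group S)"
    using Cons.prems by (intro free_reduce_in_carrier) simp
  have "free_reduce (l # w) = [(s, b)] \<otimes>\<^bsub>free_group S\<^esub> free_reduce w"
    by (simp add: l mult_free_group free_reduce_Cons free_reduce_reduced reduced_free_reduce)
  then have "N #>\<^bsub>free_group S\<^esub> free_reduce (l # w) =
      (N #>\<^bsub>free_group S\<^esub> [(s, b)]) \<otimes>\<^bsub>presented_group S R\<^esub> (N #>\<^bsub>free_group S\<^esub> free_reduce w)"
    using s w by (simp add: quot.hom_mult letter_in_carrier)
  moreover have "N #>\<^bsub>free_group S\<^esub> [(s, b)] =
      (if b then presented_gen S R s else inv\<^bsub>presented_group S R\<^esub> presented_gen S R s)"
    using quot.hom_inv[OF letter_in_carrier[OF s, of True]] s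
    by (auto simp: presented_gen_def inv_letter)
  ultimately show ?case using Cons by (simp add: l free_lift_Cons)
qed

lemma free_lift_relator:
  assumes "r \<in> R"
  shows "free_lift (presented_group S R) (presented_gen S R) r = \<one>\<^bsub>presented_group S R\<^esub>"
proof -
  have "free_reduce r \<in> N"
    using group.normal_closure_incl[OF group_free_group reduced_relators] assms by auto
  then have "N #>\<^bsub>free_group S\<^esub> free_reduce r = N"
    by (intro subgroup.rcos_const[OF normal_imp_subgroup[OF normal_N] group_free_group])
  then show ?thesis
    using relators[OF assms]
    by (simp add: free_lift_presented_gen) (simp add: presented_group_def)
qed

text \<open>The parity kills all relators, hence all of \<open>N\<close>, but not the marked
  generator \<open>s\<close>.\<close>

lemma presented_gen_neq_one:
  assumes R: "\<And>r. r \<in> R \<Longrightarrow> \<not> word_parity d r" and s: "s \<in> S" "d s"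
  shows "presented_gen S R s \<noteq> \<one>\<^bsub>presented_group S R\<^esub>"
proof
  interpret group "free_group S" by (rule group_free_group)
  let ?K = "{w \<in> carrier (free_group S). \<not> word_parity d w}"
  have K: "subgroup ?K (free_group S)"
  proof (rule subgroup.intro)
    fix u v assume "u \<in> ?K" "v \<in> ?K"
    then show "u \<otimes>\<^bsub>free_group S\<^esub> v \<in> ?K" by (simp add: word_parity_mult)
  next
    show "\<one>\<^bsub>free_group S\<^esub> \<in> ?K" using one_closed by (simp add: one_free_group)
  next
    fix u assume "u \<in> ?K"
    then show "inv\<^bsub>free_group S\<^esub> u \<in> ?K" by (simp add: word_parity_inv)
  qed simp
  have "N \<subseteq> ?K"
    \<comment> \<open>In a conjugate of a relator the parity of the conjugating element is counted
      twice, so conjugates of even words are even.\<close>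
    unfolding normal_closure_def
  proof (intro generate_subgroup_incl K UN_least)
    fix g w assume g: "g \<in> carrier (free_group S)" and w: "w \<in> free_reduce ` R"
    then have "w \<in> ?K"
      using R reduced_relators by (auto simp: word_parity_free_reduce)
    then show "{g \<otimes>\<^bsub>free_group S\<^esub> w \<otimes>\<^bsub>free_group S\<^esub> inv\<^bsub>free_group S\<^esub> g} \<subseteq> ?K"
      using g by (simp add: word_parity_mult word_parity_inv)
  qed
  moreover assume "presented_gen S R s = \<one>\<^bsub>presented_group S R\<^esub>"
  then have "N #>\<^bsub>free_group S\<^esub> [(s, True)] = N"
    by (simp add: presented_gen_def presented_group_def)
  then have "[(s, True)] \<in> N"
    by (rule coset_join1[OF _ letter_in_carrier[OF s(1)] normal_imp_subgroup[OF normal_N]])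
  ultimately show False using s by auto
qed

end

section \<open>HNN extensions\<close>

locale HNN_extension = group G for G :: "('g, 'b) monoid_scheme" (structure) +
  fixes A :: "'g set" and \<phi> :: "'g \<Rightarrow> 'g"
  assumes A_subset: "A \<subseteq> carrier G" and phi_closed: "\<phi> ` A \<subseteq> carrier G"
begin

definition "gens = insert None (Some ` carrier G)"

definition "rels =
  (\<Union>a\<in>carrier G. \<Union>b\<in>carrier G. {[(Some a, True), (Some b, True), (Some (a \<otimes> b), False)]})
  \<union> (\<Union>a\<in>A. {[(None, True), (Some a, True), (None, False), (Some (\<phi> a), False)]})"

lemma HNN_eq: "HNN G A \<phi> = presented_group gens rels"
  by (simp add: HNN_def gens_def rels_def)

sublocale presentation gens rels
  by unfold_locales (use A_subset phi_closed in \<open>auto simp: gens_def rels_def image_subset_iff subset_iff\<close>)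

abbreviation H where "H \<equiv> HNN G A \<phi>"

definition "base_incl g = presented_gen gens rels (Some g)"

definition "stable_letter = presented_gen gens rels None"

lemma group_HNN: "group H"
  unfolding HNN_eq by (rule group_presented_group)

lemma base_incl_closed: "g \<in> carrier G \<Longrightarrow> base_incl g \<in> carrier H"
  unfolding base_incl_def HNN_eq by (rule presented_gen_closed) (simp add: gens_def)

lemma stable_letter_closed: "stable_letter \<in> carrier H"
  unfolding stable_letter_def HNN_eq by (rule presented_gen_closed) (simp add: gens_def)

lemma base_incl_mult:
  assumes "a \<in> carrier G" "b \<in> carrier G"
  shows "base_incl (a \<otimes> b) = base_incl a \<otimes>\<^bsub>H\<^esub> base_incl b"
proof -
  interpret H: group H by (rule group_HNN)
  have "[(Some a, True), (Some b, True), (Some (a \<otimes> b), False)] \<in> rels"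
    using assms by (auto simp: rels_def)
  from free_lift_relator[OF this]
  have "base_incl a \<otimes>\<^bsub>H\<^esub> (base_incl b \<otimes>\<^bsub>H\<^esub> inv\<^bsub>H\<^esub> base_incl (a \<otimes> b)) = \<one>\<^bsub>H\<^esub>"
    using assms by (simp add: free_lift_Cons base_incl_closed flip: HNN_eq base_incl_def)
  then have "(base_incl a \<otimes>\<^bsub>H\<^esub> base_incl b) \<otimes>\<^bsub>H\<^esub> inv\<^bsub>H\<^esub> base_incl (a \<otimes> b) = \<one>\<^bsub>H\<^esub>"
    using assms by (simp add: H.m_assoc base_incl_closed)
  from H.inv_equality[OF this] show ?thesis
    using assms by (simp add: base_incl_closed)
qed

lemma base_incl_hom: "base_incl \<in> hom G H"
  by (rule homI) (simp_all add: base_incl_closed base_incl_mult)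

lemma stable_letter_conj:
  assumes "a \<in> A"
  shows "stable_letter \<otimes>\<^bsub>H\<^esub> base_incl a \<otimes>\<^bsub>H\<^esub> inv\<^bsub>H\<^esub> stable_letter = base_incl (\<phi> a)"
proof -
  interpret H: group H by (rule group_HNN)
  have a: "a \<in> carrier G" "\<phi> a \<in> carrier G" using assms A_subset phi_closed by auto
  have "[(None, True), (Some a, True), (None, False), (Some (\<phi> a), False)] \<in> rels"
    using assms by (auto simp: rels_def)
  from free_lift_relator[OF this]
  have "stable_letter \<otimes>\<^bsub>H\<^esub> (base_incl a \<otimes>\<^bsub>H\<^esub> (inv\<^bsub>H\<^esub> stable_letter \<otimes>\<^bsub>H\<^esub> inv\<^bsub>H\<^esub> base_incl (\<phi> a))) = \<one>\<^bsub>H\<^esub>"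
    using a by (simp add: free_lift_Cons base_incl_closed flip: HNN_eq base_incl_def stable_letter_def)
  then have "(stable_letter \<otimes>\<^bsub>H\<^esub> base_incl a \<otimes>\<^bsub>H\<^esub> inv\<^bsub>H\<^esub> stable_letter) \<otimes>\<^bsub>H\<^esub> inv\<^bsub>H\<^esub> base_incl (\<phi> a) = \<one>\<^bsub>H\<^esub>"
    using a by (simp add: H.m_assoc base_incl_closed stable_letter_closed)
  from H.inv_equality[OF this] show ?thesis
    using a by (simp add: base_incl_closed stable_letter_closed)
qed

text \<open>A full embedding of the base group would need a normal form theorem. To see that one
  element survives, a homomorphism \<open>d\<close> to Z/2 compatible with \<open>\<phi>\<close> is
  enough: it extends to the HNN extension.\<close>

lemma base_incl_neq_one:
  assumes mult: "\<And>a b. a \<in> carrier G \<Longrightarrow> b \<in> carrier G \<Longrightarrow> d (a \<otimes> b) = (d a \<noteq> d b)"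
    and phi: "\<And>a. a \<in> A \<Longrightarrow> d (\<phi> a) = d a" and g: "g \<in> carrier G" "d g"
  shows "base_incl g \<noteq> \<one>\<^bsub>H\<^esub>"
  unfolding base_incl_def HNN_eq
  \<comment> \<open>The stable letter gets parity 0. The two kinds of relators are then even by
    multiplicativity of \<open>d\<close> and by its invariance under \<open>\<phi>\<close>.\<close>
  by (rule presented_gen_neq_one[where d = "case_option False d"])
    (use assms in \<open>auto simp: gens_def rels_def\<close>)

end

section \<open>Positive cones\<close>

text \<open>The set of elements above the identity in a left order. No invariance under conjugation
  is asked, as the order need not be right invariant.\<close>

definition positive_cone :: "('g, 'b) monoid_scheme \<Rightarrow> 'g set \<Rightarrow> bool" where
  "positive_cone G P \<longleftrightarrow> \<one>\<^bsub>G\<^esub> \<notin> P \<and> (\<forall>g\<in>P. \<forall>h\<in>P. g \<otimes>\<^bsub>G\<^esub> h \<in> P)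
     \<and> (\<forall>g\<in>carrier G. g \<noteq> \<one>\<^bsub>G\<^esub> \<longrightarrow> g \<in> P \<or> inv\<^bsub>G\<^esub> g \<in> P) \<and> P \<subseteq> carrier G"

context group
begin

lemma left_orderable_positive_cone:
  assumes "left_orderable G"
  obtains P where "positive_cone G P"
proof -
  obtain le where le: "\<forall>x\<in>carrier G. \<forall>y\<in>carrier G. le x y \<and> le y x \<longrightarrow> x = y"
    "\<forall>x\<in>carrier G. \<forall>y\<in>carrier G. \<forall>z\<in>carrier G. le x y \<and> le y z \<longrightarrow> le x z"
    "\<forall>x\<in>carrier G. \<forall>y\<in>carrier G. le x y \<or> le y x"
    "\<forall>g\<in>carrier G. \<forall>x\<in>carrier G. \<forall>y\<in>carrier G. le x y \<longrightarrow> le (g \<otimes> x) (g \<otimes> y)"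
    using assms unfolding left_orderable_def by (elim exE conjE) (rule that)
  have antisym: "x = y" if "le x y" "le y x" "x \<in> carrier G" "y \<in> carrier G" for x y
    using le(1) that by blast
  have trans: "le x z" if "le x y" "le y z" "x \<in> carrier G" "y \<in> carrier G" "z \<in> carrier G" for x y z
    using le(2) that by blast
  have total: "le x y \<or> le y x" if "x \<in> carrier G" "y \<in> carrier G" for x y
    using le(3) that by blast
  have left: "le (g \<otimes> x) (g \<otimes> y)" if "le x y" "g \<in> carrier G" "x \<in> carrier G" "y \<in> carrier G" for g x y
    using le(4) that by blast
  let ?P = "{g \<in> carrier G. le \<one> g \<and> g \<noteq> \<one>}"
  have "g \<otimes> h \<in> ?P" if "g \<in> ?P" "h \<in> ?P" for g h
  proof -
    have gh: "le g (g \<otimes> h)" using left[of \<one> h g] that by simp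
    then have "le \<one> (g \<otimes> h)" using trans[of \<one> g "g \<otimes> h"] that by simp
    \<comment> \<open>If the product were the identity, \<open>g\<close> would lie both above and
      below it.\<close>
    moreover have "g \<otimes> h \<noteq> \<one>" using gh antisym[of \<one> g] that by auto
    ultimately show ?thesis using that by simp
  qed
  moreover have "g \<in> ?P \<or> inv g \<in> ?P" if "g \<in> carrier G" "g \<noteq> \<one>" for g
    using total[of \<one> g] left[of g \<one> "inv g"] that by auto
  ultimately have "positive_cone G ?P" unfolding positive_cone_def by blast
  then show ?thesis by (rule that)
qed

lemma positive_cone_inv:
  assumes "positive_cone G P" "g \<in> carrier G" "g \<noteq> \<one>"
  shows "inv g \<in> P \<longleftrightarrow> g \<notin> P"
proof
  assume "inv g \<in> P"
  then show "g \<notin> P"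
    using assms(1) r_inv[OF assms(2)] unfolding positive_cone_def by force
next
  assume "g \<notin> P"
  then show "inv g \<in> P" using assms unfolding positive_cone_def by blast
qed

text \<open>The new set is the preimage of \<open>P\<close> under an inner automorphism, so it is
  again a cone, possibly a different one.\<close>

lemma positive_cone_conj:
  assumes P: "positive_cone G P" and t: "t \<in> carrier G"
  shows "positive_cone G {g \<in> carrier G. inv t \<otimes> g \<otimes> t \<in> P}"
proof -
  have mult: "inv t \<otimes> (g \<otimes> h) \<otimes> t = (inv t \<otimes> g \<otimes> t) \<otimes> (inv t \<otimes> h \<otimes> t)"
    if "g \<in> carrier G" "h \<in> carrier G" for g h
    using that t by (simp add: m_assoc) (simp add: m_assoc[symmetric])
  have inv: "inv t \<otimes> inv g \<otimes> t = inv (inv t \<otimes> g \<otimes> t)" if "g \<in> carrier G" for g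
    using that t by (simp add: inv_mult_group m_assoc)
  have one: "inv t \<otimes> g \<otimes> t \<noteq> \<one>" if "g \<in> carrier G" "g \<noteq> \<one>" for g
  proof
    assume "inv t \<otimes> g \<otimes> t = \<one>"
    then have "inv t = inv t \<otimes> g" using that t inv_equality[of "inv t \<otimes> g" t] by simp
    then show False using that t by simp
  qed
  show ?thesis
    unfolding positive_cone_def
  proof (intro conjI ballI impI)
    show "\<one> \<notin> {g \<in> carrier G. inv t \<otimes> g \<otimes> t \<in> P}"
      using P t by (simp add: positive_cone_def)
  next
    fix g h assume "g \<in> {g \<in> carrier G. inv t \<otimes> g \<otimes> t \<in> P}" "h \<in> {g \<in> carrier G. inv t \<otimes> g \<otimes> t \<in> P}"
    then show "g \<otimes> h \<in> {g \<in> carrier G. inv t \<otimes> g \<otimes> t \<in> P}"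
      using P mult[of g h] by (simp add: positive_cone_def)
  next
    fix g assume "g \<in> carrier G" "g \<noteq> \<one>"
    then show "g \<in> {g \<in> carrier G. inv t \<otimes> g \<otimes> t \<in> P} \<or> inv g \<in> {g \<in> carrier G. inv t \<otimes> g \<otimes> t \<in> P}"
      using t inv[of g] one[of g] positive_cone_inv[OF P, of "inv t \<otimes> g \<otimes> t"] by simp
  qed blast
qed

text \<open>If \<open>x\<close> is positive, multiplying by it on both sides preserves positivity.
  If its inverse is positive, the same holds for the step backwards, and if \<open>x\<close> is
  trivial the sequence is constant.\<close>

lemma sandwich_monotone:
  assumes P: "positive_cone G P" and x: "x \<in> carrier G"
    and g: "\<And>n. g n \<in> carrier G" "\<And>n::int. g (n + 1) = x \<otimes> g n \<otimes> x"
  shows "(\<forall>n. g n \<in> P \<longrightarrow> g (n + 1) \<in> P) \<or> (\<forall>n. g (n + 1) \<in> P \<longrightarrow> g n \<in> P)"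
proof -
  have backward: "g n = inv x \<otimes> g (n + 1) \<otimes> inv x" for n
    using x g(1) by (simp add: g(2) m_assoc) (simp add: m_assoc[symmetric])
  consider "x = \<one>" | "x \<in> P" | "inv x \<in> P"
    using P x unfolding positive_cone_def by blast
  then show ?thesis
  proof cases
    case 1
    then show ?thesis using g by simp
  next
    case 2
    then have "x \<otimes> h \<otimes> x \<in> P" if "h \<in> P" for h
      using P that by (simp add: positive_cone_def)
    then show ?thesis by (simp add: g(2))
  next
    case 3
    then have "inv x \<otimes> h \<otimes> inv x \<in> P" if "h \<in> P" for h
      using P that by (simp add: positive_cone_def)
    then show ?thesis by (metis backward)
  qed
qed

text \<open>The sign of g n changes at most once in n for any left order. Conjugating an order by t
  flips the signs of g 1 and g 3 but not those of g 0 and g 2, which produces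
  at least two changes among three steps.\<close>
lemma not_left_orderable_alternating:
  assumes x: "x \<in> carrier G" and t: "t \<in> carrier G"
    and g: "\<And>n. g n \<in> carrier G" "\<And>n::int. g (n + 1) = x \<otimes> g n \<otimes> x" "\<And>n. g n \<noteq> \<one>"
    and conj: "\<And>n. t \<otimes> g n \<otimes> inv t = (if even n then g n else inv (g n))"
  shows "\<not> left_orderable G"
proof
  assume "left_orderable G"
  then obtain P where P: "positive_cone G P" by (rule left_orderable_positive_cone)
  define P' where "P' = {h \<in> carrier G. inv t \<otimes> h \<otimes> t \<in> P}"
  have P': "positive_cone G P'"
    unfolding P'_def by (rule positive_cone_conj[OF P t])
  have "inv t \<otimes> (t \<otimes> g n \<otimes> inv t) \<otimes> t = g n" for n
    using t g(1) by (simp add: m_assoc) (simp add: m_assoc[symmetric])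
  \<comment> \<open>Membership of the conjugate in \<open>P'\<close> reads off the sign of
    \<open>g n\<close> in \<open>P\<close>. The hypothesis \<open>conj\<close> rewrites that
    conjugate as \<open>g n\<close> or its inverse.\<close>
  then have mem: "t \<otimes> g n \<otimes> inv t \<in> P' \<longleftrightarrow> g n \<in> P" for n
    unfolding P'_def using t g(1) by simp
  have even: "g n \<in> P' \<longleftrightarrow> g n \<in> P" if "even n" for n
    using mem[of n] conj[of n] that by simp
  have odd: "g n \<in> P' \<longleftrightarrow> g n \<notin> P" if "odd n" for n
    using mem[of n] conj[of n] that positive_cone_inv[OF P' g(1,3)] by auto
  have "g 0 \<in> P' \<longleftrightarrow> g 0 \<in> P" "g 1 \<in> P' \<longleftrightarrow> g 1 \<notin> P" "g 2 \<in> P' \<longleftrightarrow> g 2 \<in> P" "g 3 \<in> P' \<longleftrightarrow> g 3 \<notin> P"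
    by (auto intro!: even odd)
  moreover have "(\<forall>n\<in>{0, 1, 2}. g n \<in> Q \<longrightarrow> g (n + 1) \<in> Q) \<or> (\<forall>n\<in>{0, 1, 2}. g (n + 1) \<in> Q \<longrightarrow> g n \<in> Q)"
    if "positive_cone G Q" for Q
    using sandwich_monotone[of Q x g, OF that x g(1,2)] by blast
  from this[OF P] this[OF P']
  have "(g 0 \<in> P \<longrightarrow> g 1 \<in> P) \<and> (g 1 \<in> P \<longrightarrow> g 2 \<in> P) \<and> (g 2 \<in> P \<longrightarrow> g 3 \<in> P)
      \<or> (g 1 \<in> P \<longrightarrow> g 0 \<in> P) \<and> (g 2 \<in> P \<longrightarrow> g 1 \<in> P) \<and> (g 3 \<in> P \<longrightarrow> g 2 \<in> P)"
    "(g 0 \<in> P' \<longrightarrow> g 1 \<in> P') \<and> (g 1 \<in> P' \<longrightarrow> g 2 \<in> P') \<and> (g 2 \<in> P' \<longrightarrow> g 3 \<in> P')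
      \<or> (g 1 \<in> P' \<longrightarrow> g 0 \<in> P') \<and> (g 2 \<in> P' \<longrightarrow> g 1 \<in> P') \<and> (g 3 \<in> P' \<longrightarrow> g 2 \<in> P')"
    by simp_all
  \<comment> \<open>Each of the three steps is a sign change for exactly one of \<open>P\<close> and
    \<open>P'\<close>, which makes three changes in total. Monotonicity allows each cone at most
    one.\<close>
  ultimately show False by argo
qed

end

section \<open>The free family x^n p x^n\<close>

locale two_generators =
  fixes S :: "'a set" and x p :: 'a
  assumes x: "x \<in> S" and p: "p \<in> S" and x_neq_p: "x \<noteq> p"
begin

abbreviation F where "F \<equiv> free_group S"
abbreviation x_letter :: "('a \<times> bool) list" where "x_letter \<equiv> [(x, True)]"

sublocale F: group F by (rule group_free_group)

lemma x_letter_closed: "x_letter \<in> carrier F" and p_closed: "[(p, b)] \<in> carrier F"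
  by (simp_all add: letter_in_carrier x p)

text \<open>The same power stands on both sides, unlike in a conjugate. This makes consecutive terms
  differ by two factors of the same sign, as \<open>sandwich_monotone\<close> needs.\<close>

definition sandwich :: "int \<Rightarrow> ('a \<times> bool) list" where
  "sandwich n = x_letter [^]\<^bsub>F\<^esub> n \<otimes>\<^bsub>F\<^esub> [(p, True)] \<otimes>\<^bsub>F\<^esub> x_letter [^]\<^bsub>F\<^esub> n"

lemma sandwich_closed: "sandwich n \<in> carrier F"
  by (simp add: sandwich_def x_letter_closed p_closed)

lemma sandwich_step: "sandwich (n + 1) = x_letter \<otimes>\<^bsub>F\<^esub> sandwich n \<otimes>\<^bsub>F\<^esub> x_letter"
proof -
  have "x_letter \<otimes>\<^bsub>F\<^esub> x_letter [^]\<^bsub>F\<^esub> n = x_letter [^]\<^bsub>F\<^esub> (n + 1)"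
    and "x_letter [^]\<^bsub>F\<^esub> n \<otimes>\<^bsub>F\<^esub> x_letter = x_letter [^]\<^bsub>F\<^esub> (n + 1)"
    using F.int_pow_mult[OF x_letter_closed, of 1 n] F.int_pow_mult[OF x_letter_closed, of n 1]
    by (simp_all add: x_letter_closed add.commute)
  then have "sandwich (n + 1) = (x_letter \<otimes>\<^bsub>F\<^esub> x_letter [^]\<^bsub>F\<^esub> n) \<otimes>\<^bsub>F\<^esub> [(p, True)] \<otimes>\<^bsub>F\<^esub> (x_letter [^]\<^bsub>F\<^esub> n \<otimes>\<^bsub>F\<^esub> x_letter)"
    by (simp only: sandwich_def)
  then show ?thesis
    by (simp add: sandwich_def F.m_assoc x_letter_closed p_closed)
qed

text \<open>The action of F on the product of the free group on the integers with the integers: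
  x translates the second factor, and p sends (w, n) to (n w, -n), so that the
  n-th sandwich multiplies w by the n-th generator on the slice over 0.\<close>
definition act :: "'a \<times> bool \<Rightarrow> (int \<times> bool) list \<times> int \<Rightarrow> (int \<times> bool) list \<times> int" where
  "act l q = (if fst l = x then (fst q, if snd l then snd q + 1 else snd q - 1)
    else if fst l = p
      then (cancel_cons (if snd l then snd q else - snd q, snd l) (fst q), - snd q)
    else q)"

text \<open>Opposite letters act inversely: \<open>p\<close> negates the second coordinate, so its
  inverse must remove the generator with index \<open>- snd q\<close>.\<close>

lemma act_mult:
  assumes "reduced w"
  shows "foldr act (u \<otimes>\<^bsub>F\<^esub> v) (w, n) = foldr act u (foldr act v (w, n))"
  by (rule foldr_mult_free_group[where Q = "{q. reduced (fst q)}"])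
    (use assms in \<open>auto simp: act_def reduced_cancel_cons cancel_cons_inverse[where b = True, simplified]
      cancel_cons_inverse[where b = False, simplified]\<close>)

lemma act_inv:
  assumes "foldr act u (w, n) = q" "u \<in> carrier F" "reduced w"
  shows "foldr act (inv\<^bsub>F\<^esub> u) q = (w, n)"
  using act_mult[of w "inv\<^bsub>F\<^esub> u" u n] assms by (simp add: one_free_group)

lemma act_nat_pow: "reduced w \<Longrightarrow> foldr act (x_letter [^]\<^bsub>F\<^esub> k) (w, n) = (w, n + int k)" for k :: nat
  by (induction k arbitrary: n) (simp_all add: act_mult one_free_group act_def)

lemma act_int_pow:
  fixes k :: int
  assumes "reduced w"
  shows "foldr act (x_letter [^]\<^bsub>F\<^esub> k) (w, n) = (w, n + k)"
proof (cases k rule: int_cases2)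
  case (nonneg m)
  then show ?thesis by (simp add: int_pow_int act_nat_pow assms)
next
  case (nonpos m)
  have "foldr act (x_letter [^]\<^bsub>F\<^esub> m) (w, n + k) = (w, n)"
    using nonpos assms by (simp add: act_nat_pow)
  then have "foldr act (inv\<^bsub>F\<^esub> (x_letter [^]\<^bsub>F\<^esub> m)) (w, n) = (w, n + k)"
    using assms by (intro act_inv) (simp_all add: x_letter_closed)
  then show ?thesis using nonpos by (simp add: F.int_pow_neg_int x_letter_closed)
qed

text \<open>The rightmost factor acts first: the second coordinate goes from 0 to \<open>n\<close>,
  then \<open>p\<close> prepends the generator \<open>n\<close> and moves to \<open>- n\<close>, and
  the left power returns to 0.\<close>

lemma act_sandwich:
  assumes "reduced w"
  shows "foldr act (sandwich n) (w, 0) = (cancel_cons (n, True) w, 0)"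
  using assms x_neq_p
  by (simp add: sandwich_def act_mult act_int_pow act_def reduced_cancel_cons)

lemma act_inv_sandwich:
  assumes "reduced w"
  shows "foldr act (inv\<^bsub>F\<^esub> sandwich n) (w, 0) = (cancel_cons (n, False) w, 0)"
proof (rule act_inv)
  show "foldr act (sandwich n) (cancel_cons (n, False) w, 0) = (w, 0)"
    using assms cancel_cons_inverse[OF assms, of n True]
    by (simp add: act_sandwich reduced_cancel_cons)
qed (simp_all add: sandwich_closed reduced_cancel_cons assms)

section \<open>Freeness of the family of sandwiches\<close>

abbreviation sandwich_lift :: "(int \<times> bool) list \<Rightarrow> ('a \<times> bool) list" where
  "sandwich_lift \<equiv> free_lift F sandwich"

lemma sandwich_lift_hom: "sandwich_lift \<in> hom (free_group UNIV) F"
  by (rule F.free_lift_hom) (simp add: sandwich_closed)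

text \<open>The orbit of the base point \<open>([], 0)\<close> recovers \<open>w\<close> from its
  image in \<open>F\<close>, which provides a left inverse of \<open>sandwich_lift\<close>.\<close>

lemma act_sandwich_lift: "reduced w \<Longrightarrow> foldr act (sandwich_lift w) ([], 0) = (w, 0)"
proof (induction w)
  case (Cons l w)
  obtain n b where l: "l = (n, b)" by (cases l)
  have w: "reduced w" using Cons.prems by (rule reduced_tl)
  then show ?case
    using Cons.IH cancel_cons_reduced[OF Cons.prems]
    by (cases b) (simp_all add: l free_lift_Cons act_mult act_sandwich act_inv_sandwich)
qed (simp add: one_free_group)

lemma inj_on_sandwich_lift: "inj_on sandwich_lift (carrier (free_group UNIV))"
proof (rule inj_onI)
  fix v w assume v: "v \<in> carrier (free_group UNIV)" and w: "w \<in> carrier (free_group UNIV)"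
    and eq: "sandwich_lift v = sandwich_lift w"
  have "(v, 0) = foldr act (sandwich_lift v) ([], 0)"
    using v by (intro act_sandwich_lift[symmetric]) (simp add: carrier_free_group)
  also have "\<dots> = foldr act (sandwich_lift w) ([], 0)"
    by (simp only: eq)
  also have "\<dots> = (w, 0)"
    using w by (intro act_sandwich_lift) (simp add: carrier_free_group)
  finally show "v = w" by simp
qed

section \<open>Parity of the exponent of p\<close>

abbreviation parity where "parity \<equiv> word_parity (\<lambda>s. s = p)"

lemma parity_sandwich: "parity (sandwich n)"
  unfolding sandwich_def using x_neq_p by (simp add: word_parity_mult)

text \<open>Every sandwich and its inverse have odd parity, so each letter of \<open>w\<close>
  contributes one.\<close>

lemma parity_sandwich_lift: "parity (sandwich_lift w) = odd (length w)"
proof (induction w)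
  case (Cons l w)
  then show ?case
    by (cases l) (simp add: free_lift_Cons word_parity_mult word_parity_inv sandwich_closed
        parity_sandwich)
qed (simp add: one_free_group)

end

section \<open>The isomorphism\<close>

text \<open>The automorphism of the free group on the integers that inverts the odd generators and
  fixes the even ones.\<close>

definition alternate :: "(int \<times> bool) list \<Rightarrow> (int \<times> bool) list" where
  "alternate = map (\<lambda>l. (fst l, snd l = even (fst l)))"

lemma alternate_alternate: "alternate (alternate w) = w"
  by (induction w) (auto simp: alternate_def)

text \<open>Whether a sign is flipped depends only on the index, so adjacent letters with equal
  index stay equal or stay opposite.\<close>

lemma reduced_alternate: "reduced (alternate w) = reduced w"
  by (induction w rule: reduced.induct) (auto simp: alternate_def)

lemma alternate_cancel_cons:
  "alternate (cancel_cons l w) = cancel_cons (fst l, snd l = even (fst l)) (alternate w)"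
  by (cases w) (auto simp: alternate_def cancel_cons_def)

lemma alternate_free_reduce: "alternate (free_reduce w) = free_reduce (alternate w)"
proof (induction w)
  case (Cons l w)
  then show ?case
    by (simp add: free_reduce_Cons alternate_cancel_cons)
      (simp add: alternate_def free_reduce_Cons)
qed (simp add: alternate_def)

lemma alternate_iso: "alternate \<in> iso (free_group UNIV) (free_group UNIV)"
proof (rule isoI)
  show "alternate \<in> hom (free_group UNIV) (free_group UNIV)"
    by (rule homI)
      (simp_all add: carrier_free_group mult_free_group reduced_alternate alternate_free_reduce,
        simp add: alternate_def)
  show "bij_betw alternate (carrier (free_group UNIV)) (carrier (free_group UNIV))"
    by (rule bij_betw_byWitness[where f' = alternate])
      (auto simp: alternate_alternate carrier_free_group reduced_alternate)
qed

context two_generators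
begin

definition "A = sandwich_lift ` carrier (free_group UNIV)"

text \<open>This is \<open>alternate\<close> transported to \<open>A\<close> along
  \<open>sandwich_lift\<close>.\<close>

definition "\<phi> = sandwich_lift \<circ> alternate \<circ> inv_into (carrier (free_group UNIV)) sandwich_lift"

lemma subgroup_A: "subgroup A F"
  unfolding A_def
  by (rule group_hom.img_is_subgroup)
    (simp add: group_hom_def group_hom_axioms_def group_free_group sandwich_lift_hom)

lemma sandwich_lift_iso: "sandwich_lift \<in> iso (free_group UNIV) (F\<lparr>carrier := A\<rparr>)"
  using sandwich_lift_hom inj_on_sandwich_lift
  by (auto simp: iso_iff A_def hom_def)

lemma phi_iso: "\<phi> \<in> iso (F\<lparr>carrier := A\<rparr>) (F\<lparr>carrier := A\<rparr>)"
  unfolding \<phi>_def comp_assoc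
  by (rule iso_set_trans[OF iso_set_trans[OF
      group.iso_set_sym[OF group_free_group sandwich_lift_iso] alternate_iso] sandwich_lift_iso])

lemma phi_sandwich_lift:
  "w \<in> carrier (free_group UNIV) \<Longrightarrow> \<phi> (sandwich_lift w) = sandwich_lift (alternate w)"
  by (simp add: \<phi>_def inj_on_sandwich_lift)

lemma sandwich_eq_lift: "sandwich n = sandwich_lift [(n, True)]"
  by (simp add: free_lift_Cons sandwich_closed)

lemma sandwich_in_A: "sandwich n \<in> A"
  unfolding A_def by (rule image_eqI, rule sandwich_eq_lift) (simp add: letter_in_carrier)

lemma phi_sandwich: "\<phi> (sandwich n) = (if even n then sandwich n else inv\<^bsub>F\<^esub> sandwich n)"
proof -
  have "\<phi> (sandwich n) = \<phi> (sandwich_lift [(n, True)])"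
    by (rule arg_cong[OF sandwich_eq_lift])
  also have "\<dots> = sandwich_lift (alternate [(n, True)])"
    by (rule phi_sandwich_lift) (simp add: letter_in_carrier)
  finally show ?thesis
    by (simp add: alternate_def free_lift_Cons sandwich_closed)
qed

text \<open>On \<open>A\<close> the parity is word length modulo 2, and \<open>alternate\<close>
  preserves length.\<close>

lemma parity_phi: "a \<in> A \<Longrightarrow> parity (\<phi> a) = parity a"
  by (auto simp: A_def phi_sandwich_lift parity_sandwich_lift alternate_def)

section \<open>The sandwiches inside the HNN extension\<close>

lemma HNN_not_left_orderable: "\<not> left_orderable (HNN F A \<phi>)"
proof -
  interpret HNN_extension F A \<phi>
  proof
    show "A \<subseteq> carrier F" using subgroup_A by (rule subgroup.subset)
    then show "\<phi> ` A \<subseteq> carrier F" using phi_iso by (auto simp: iso_iff)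
  qed
  interpret base_incl: group_hom F H base_incl
    using group_free_group group_HNN base_incl_hom by (simp add: group_hom_def group_hom_axioms_def)
  show ?thesis
  proof (rule group.not_left_orderable_alternating[OF group_HNN base_incl_closed[OF x_letter_closed] stable_letter_closed])
    fix n
    show "base_incl (sandwich n) \<in> carrier H" by (rule base_incl_closed[OF sandwich_closed])
    show "base_incl (sandwich (n + 1)) = base_incl x_letter \<otimes>\<^bsub>H\<^esub> base_incl (sandwich n) \<otimes>\<^bsub>H\<^esub> base_incl x_letter"
      by (simp add: sandwich_step base_incl.hom_mult sandwich_closed x_letter_closed)
    show "base_incl (sandwich n) \<noteq> \<one>\<^bsub>H\<^esub>"
      by (rule base_incl_neq_one[where d = parity])
        (simp_all add: word_parity_mult parity_phi sandwich_closed parity_sandwich)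
    show "stable_letter \<otimes>\<^bsub>H\<^esub> base_incl (sandwich n) \<otimes>\<^bsub>H\<^esub> inv\<^bsub>H\<^esub> stable_letter =
        (if even n then base_incl (sandwich n) else inv\<^bsub>H\<^esub> base_incl (sandwich n))"
      by (simp add: stable_letter_conj sandwich_in_A phi_sandwich base_incl.hom_inv sandwich_closed)
  qed
qed

end

theorem theorem1p2:
  fixes S :: "'a set"
  assumes "\<exists>x\<in>S. \<exists>y\<in>S. x \<noteq> y"
  shows "\<exists>A B \<phi>. subgroup A (free_group S) \<and> subgroup B (free_group S)
           \<and> \<phi> \<in> iso ((free_group S)\<lparr>carrier := A\<rparr>) ((free_group S)\<lparr>carrier := B\<rparr>)
           \<and> \<not> left_orderable (HNN (free_group S) A \<phi>)"
proof -
  obtain x p where "x \<in> S" "p \<in> S" "x \<noteq> p" using assms by blast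
  then interpret two_generators S x p by unfold_locales
  \<comment> \<open>Both subgroups are taken to be \<open>A\<close>, since \<open>\<phi>\<close> is
    an automorphism of it.\<close>
  show ?thesis using subgroup_A phi_iso HNN_not_left_orderable by blast
qed

end
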